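(* For every context $\Gamma$, query $Q$, schema $\tau$ and evaluation $S$, if $[\![\Gamma\vdash Q:\tau]\!]^{\mathsf{3VL}}\Downarrow S$, then there exists $S'$ such that $[\![\Gamma\vdash Q^{\mathbf{tt}}:\tau]\!]^{\mathsf{2VL}}\Downarrow S'$ and $S\,\eta = S'\,\eta$ for every environment $\eta$ for $\Gamma$.
   Context: Syntax. Values are constants $\mathbf{k}$ or $\mathtt{NULL}$. A schema is a finite list of names; a context $\Gamma$ is a finite list of schemas, $\Gamma(n)$ its $n$-th element (0-based). Terms: $t::=n.x\mid\mathbf{k}\mid\mathtt{NULL}$. Queries: $\mathtt{SELECT}~[\mathtt{DISTINCT}]~\vec{t{:}x}~\mathtt{FROM}~T_1{:}\sigma_1,\dots,T_l{:}\sigma_l~\mathtt{WHERE}~c$, $\mathtt{SELECT}~[\mathtt{DISTINCT}]~\ast~\mathtt{FROM}~\vec{T{:}\sigma}~\mathtt{WHERE}~c$, $Q_1~op~[\mathtt{ALL}]~Q_2$ with $op\in\{\mathtt{UNION},\mathtt{INTERSECT},\mathtt{EXCEPT}\}$. Conditions: $\mathtt{TRUE},\mathtt{FALSE}, t~\mathtt{IS}~[\mathtt{NOT}]~\mathtt{NULL}, \vec t~[\mathtt{NOT}]~\mathtt{IN}~Q, P^n(t_1,\dots,t_n)$ ($P^n$ any function from $n$-lists of constants to booleans; $t=t'$ denotes the equality predicate), $\mathtt{EXISTS}~Q$, AND, OR, NOT. Tables: $\mathit{table}~x$ or $\mathit{query}~Q$. A database assigns to some names $x$ a schema $D(x)$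 and a finite multiset $D_{rel}(x)$ of $|D(x)|$-tuples of values. Translation $(\cdot)^{\mathbf{tt}}$ on queries, tables, conditions, mutually with $(\cdot)^{\mathbf{ff}}$ on conditions. Queries: $(\mathtt{SELECT}~[\mathtt{DISTINCT}]~\vec{t{:}x}~\mathtt{FROM}~\vec{T{:}\sigma}~\mathtt{WHERE}~c)^{\mathbf{tt}} = \mathtt{SELECT}~[\mathtt{DISTINCT}]~\vec{t{:}x}~\mathtt{FROM}~\vec{T^{\mathbf{tt}}{:}\sigma}~\mathtt{WHERE}~c^{\mathbf{tt}}$, similarly for $\mathtt{SELECT}~\ast$; set operations commute with $(\cdot)^{\mathbf{tt}}$ (keeping ALL). Tables: $(\mathit{table}~x)^{\mathbf{tt}}=\mathit{table}~x$, $(\mathit{query}~Q)^{\mathbf{tt}}=\mathit{query}~Q^{\mathbf{tt}}$. Conditions: $\mathtt{TRUE},\mathtt{FALSE}$, $t~\mathtt{IS}~[\mathtt{NOT}]~\mathtt{NULL}$, $P^n(\vec t)$ are unchanged by $\mathbf{tt}$; $(\mathtt{EXISTS}~Q)^{\mathbf{tt}}=\mathtt{EXISTS}~Q^{\mathbf{tt}}$; AND/OR commute with $\mathbf{tt}$; $(\mathtt{NOT}~c)^{\mathbf{tt}}=c^{\mathbf{ff}}$. $\mathtt{TRUE}^{\mathbf{ff}}=\mathtt{FALSE}$, $\mathtt{FALSE}^{\mathbf{ff}}=\mathtt{TRUE}$, $(t~\mathtt{IS}~\mathtt{NULL})^{\mathbf{ff}}=t~\mathtt{IS}~\mathtt{NOT}~\mathtt{NULL}$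 and vice versa, $P^n(\vec t)^{\mathbf{ff}}=\mathtt{NOT}~P^n(\vec t)~\mathtt{AND}~(t_1~\mathtt{IS}~\mathtt{NOT}~\mathtt{NULL}~\mathtt{AND}(\dots\mathtt{AND}(t_n~\mathtt{IS}~\mathtt{NOT}~\mathtt{NULL}~\mathtt{AND}~\mathtt{TRUE})))$, $(\mathtt{EXISTS}~Q)^{\mathbf{ff}}=\mathtt{NOT}~\mathtt{EXISTS}~Q^{\mathbf{tt}}$, $(c_1~\mathtt{AND}~c_2)^{\mathbf{ff}}=c_1^{\mathbf{ff}}~\mathtt{OR}~c_2^{\mathbf{ff}}$, $(c_1~\mathtt{OR}~c_2)^{\mathbf{ff}}=c_1^{\mathbf{ff}}~\mathtt{AND}~c_2^{\mathbf{ff}}$, $(\mathtt{NOT}~c)^{\mathbf{ff}}=c^{\mathbf{tt}}$. Membership: $(\vec t~\mathtt{IN}~Q)^{\mathbf{tt}}=(\vec t~\mathtt{NOT}~\mathtt{IN}~Q)^{\mathbf{ff}}=\vec t~\mathtt{IN}~Q^{\mathbf{tt}}$, and $(\vec t~\mathtt{NOT}~\mathtt{IN}~Q)^{\mathbf{tt}}=(\vec t~\mathtt{IN}~Q)^{\mathbf{ff}}=\mathtt{NOT}~\mathtt{EXISTS}~(\mathtt{SELECT}~\ast~\mathtt{FROM}~\mathit{query}~Q^{\mathbf{tt}}{:}(a_1,\dots,a_m)~\mathtt{WHERE}~C_1~\mathtt{AND}(\dots\mathtt{AND}(C_m~\mathtt{AND}~\mathtt{TRUE})))$, where $m=|\vec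 t|$, $a_1,\dots,a_m$ are pairwise distinct fresh names, $C_i = 0.a_i~\mathtt{IS}~\mathtt{NULL}~\mathtt{OR}~(t_i^+~\mathtt{IS}~\mathtt{NULL}~\mathtt{OR}~t_i^+=0.a_i)$, and $t^+$ increments the de Bruijn index of an attribute term by $1$ ($(n.x)^+=(n{+}1).x$, constants and NULL unchanged). Relations and environments: relations are finite multisets of tuples with $\oplus$ (sum of multiplicities), $\cap$ (min), $\setminus$ (truncated difference), $\times$ (product), $\sigma_p$ (filter), $\sum_{v\leftarrow r}f(v)$ (comprehension), $\|\cdot\|$ (deduplication), $\mathtt{card}$ (total multiplicity). An environment for $\Gamma=\sigma_1,\dots,\sigma_k$ is a list of value lists of lengths $|\sigma_i|$; $[\Gamma'\mapsto v]$ splits a tuple into an environment for $\Gamma'$; $\mathbin{++}$ concatenates environments. Truth values: $\mathsf{3VL}$ uses Kleene logic (btrue, bfalse, bmaybe $=$ ttrue, tfalse, unknown); $\mathsf{2VL}$ uses Booleans with btrue $=$ true and bfalse $=$ bmaybe $=$ false. $\mathrm{of\_bool}$, $\mathrm{is\_btrue}$, $\mathrm{is\_bfalse}$ as usual; $\mathrm{veq}(v,w)=$ bmaybe if $v$ or $w$ is NULL, else $\mathrm{of\_bool}(v=w)$. Semantics $[\![\cdot]\!]^{\mathbf{B}}\Downarrow$ (inductive relation). Terms: $n.x$ in $\Gamma$ evaluates (only if $x$ occurs exactly once in $\Gamma(n)$) to the corresponding entry of the $n$-th list of the environment; constants/NULL to themselves; term lists componentwise. Tables: $\mathit{table}~x$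 to $D_{rel}(x)$ with schema $D(x)$; $\mathit{query}~Q$ as $Q$. FROM lists $T_1{:}\rho_1,\dots,T_l{:}\rho_l$ (each $T_i$ evaluating with a schema of length $|\rho_i|$) evaluate to context $\Gamma'=\rho_1,\dots,\rho_l$ and the product of the $T_i$'s evaluations (the singleton empty tuple if $l=0$). $\mathtt{SELECT}~[\mathtt{DISTINCT}]~\vec{t{:}x}~\mathtt{FROM}\dots\mathtt{WHERE}~c$ has schema $\vec x$ and evaluates to $\eta\mapsto\sum_{v\leftarrow\sigma_p(S_F\eta)}S_t([\Gamma'\mapsto v]\mathbin{++}\eta)$, with $p(v)=\mathrm{is\_btrue}(S_c([\Gamma'\mapsto v]\mathbin{++}\eta))$, $c$ and $\vec t$ evaluated in context $\Gamma',\Gamma$, deduplicated under DISTINCT (so the first FROM table has index $0$). $\mathtt{SELECT}~\ast$: same with $\vec t$ all terms $(i{-}1).x$, $x\in\rho_i$, in order (which must evaluate), schema the concatenation of $\Gamma'$. Set operations on two queries with the same schema: UNION ALL $\oplus$, UNION $\|\oplus\|$, INTERSECT ALL $\cap$, INTERSECT $\|\cap\|$, EXCEPT ALL $\setminus$, EXCEPT $\|S_1\eta\|\setminus S_2\eta$. Nested queries (used by EXISTS) evaluate to whether $\mathtt{card}>0$ of the analogous relation, except that for $\mathtt{SELECT}~\ast$ the star terms are not evaluated. Conditions: TRUE$\mapsto$btrue, FALSE$\mapsto$bfalse; IS NULL $\mapsto\mathrm{of\_bool}(S_t\eta=\mathtt{NULL})$, IS NOT NULL its complement; $P^n(\vec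 t)$ (requires $|\vec t|=n$): bmaybe if some argument value is NULL, else $\mathrm{of\_bool}(P^n(\dots))$; EXISTS $Q\mapsto\mathrm{of\_bool}$ of the nested-query result; $\vec t~\mathtt{IN}~Q$ (with $Q$ of schema length $|\vec t|$): $\mathrm{of\_bool}(\mathrm{true})$ if some tuple $w$ of $S_Q\eta$ has $\mathrm{is\_btrue}(\mathrm{veq}(w_i,(S_{\vec t}\eta)_i))$ for all $i$, else bmaybe if some $w$ has $\neg\mathrm{is\_bfalse}(\mathrm{veq}(w_i,(S_{\vec t}\eta)_i))$ for all $i$, else $\mathrm{of\_bool}(\mathrm{false})$; NOT IN exchanges true and false in the of\_bool cases; AND, OR, NOT via the connectives of $\mathbf{B}$. *)

theory Defs
  imports "HOL-Library.Multiset"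
begin

section \<open>Syntax\<close>

text \<open>Names have type \<open>'x\<close>, constants have type \<open>'k\<close>. A value is \<open>None\<close> for NULL and
  \<open>Some k\<close> for a constant.\<close>

type_synonym 'k val = "'k option"
type_synonym 'x schema = "'x list"
type_synonym 'x ctx = "'x schema list"

datatype (tm_names: 'x, 'k) tm = Attr nat 'x | Const 'k | NullTm

datatype setop = OpUnion | OpIntersect | OpExcept

text \<open>The flag of \<open>Select\<close> and \<open>SelectStar\<close> is DISTINCT, that of \<open>SetOp\<close> is ALL.
  \<open>IsNull True t\<close> is IS NULL and \<open>IsNull False t\<close> is IS NOT NULL; likewise \<open>Memb True\<close> is IN
  and \<open>Memb False\<close> is NOT IN.
  \<open>Pred n P ts\<close> applies an \<open>n\<close>-ary predicate; only the values of \<open>P\<close> on lists of length \<open>n\<close>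
  are ever used. \<open>query_names\<close> is the set of all names occurring in a query.\<close>

datatype (query_names: 'x, 'k) query =
    Select bool "(('x, 'k) tm \<times> 'x) list" "(('x, 'k) table \<times> 'x schema) list" "('x, 'k) cond"
  | SelectStar bool "(('x, 'k) table \<times> 'x schema) list" "('x, 'k) cond"
  | SetOp setop bool "('x, 'k) query" "('x, 'k) query"
and (table_names: 'x, 'k) table =
    BaseTable 'x
  | QueryTable "('x, 'k) query"
and (cond_names: 'x, 'k) cond =
    CTrue
  | CFalse
  | IsNull bool "('x, 'k) tm"
  | Memb bool "('x, 'k) tm list" "('x, 'k) query"
  | Pred nat "'k list \<Rightarrow> bool" "('x, 'k) tm list"
  | CExists "('x, 'k) query"
  | CAnd "('x, 'k) cond" "('x, 'k) cond"
  | COr "('x, 'k) cond" "('x, 'k) cond"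
  | CNot "('x, 'k) cond"

definition eq_cond :: "('x, 'k) tm \<Rightarrow> ('x, 'k) tm \<Rightarrow> ('x, 'k) cond" where
  "eq_cond t u = Pred 2 (\<lambda>ks. ks ! 0 = ks ! 1) [t, u]"

definition conj_list :: "('x, 'k) cond list \<Rightarrow> ('x, 'k) cond" where
  "conj_list cs = foldr CAnd cs CTrue"

section \<open>Translation\<close>

fun lift_tm :: "('x, 'k) tm \<Rightarrow> ('x, 'k) tm" where
  "lift_tm (Attr n x) = Attr (Suc n) x"
| "lift_tm (Const k) = Const k"
| "lift_tm NullTm = NullTm"

text \<open>\<open>fresh m X\<close> returns \<open>m\<close> pairwise distinct names outside the finite set \<open>X\<close>. Such a
  \<open>fresh\<close> exists exactly when the type of names is infinite.\<close>

definition name_supply :: "(nat \<Rightarrow> 'x set \<Rightarrow> 'x list) \<Rightarrow> bool" where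
  "name_supply fresh \<longleftrightarrow>
    (\<forall>m X. finite X \<longrightarrow>
      length (fresh m X) = m \<and> distinct (fresh m X) \<and> set (fresh m X) \<inter> X = {})"

text \<open>The translation of \<open>Memb False ts Q\<close>, where \<open>Q'\<close> is the translation of \<open>Q\<close>.\<close>

definition tr_not_in ::
  "(nat \<Rightarrow> 'x set \<Rightarrow> 'x list) \<Rightarrow> ('x, 'k) tm list \<Rightarrow> ('x, 'k) query \<Rightarrow> ('x, 'k) cond" where
  "tr_not_in fresh ts Q' =
    (let as = fresh (length ts) (cond_names (Memb True ts Q')) in
      CNot (CExists (SelectStar False [(QueryTable Q', as)]
        (conj_list (map2
          (\<lambda>a t. COr (IsNull True (Attr 0 a))
                   (COr (IsNull True (lift_tm t)) (eq_cond (lift_tm t) (Attr 0 a))))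
          as ts)))))"

fun tt_query :: "(nat \<Rightarrow> 'x set \<Rightarrow> 'x list) \<Rightarrow> ('x, 'k) query \<Rightarrow> ('x, 'k) query"
and tt_table :: "(nat \<Rightarrow> 'x set \<Rightarrow> 'x list) \<Rightarrow> ('x, 'k) table \<Rightarrow> ('x, 'k) table"
and tt_cond :: "(nat \<Rightarrow> 'x set \<Rightarrow> 'x list) \<Rightarrow> ('x, 'k) cond \<Rightarrow> ('x, 'k) cond"
and ff_cond :: "(nat \<Rightarrow> 'x set \<Rightarrow> 'x list) \<Rightarrow> ('x, 'k) cond \<Rightarrow> ('x, 'k) cond" where
  "tt_query fresh (Select d txs Ts c) =
     Select d txs (map (\<lambda>(T, \<sigma>). (tt_table fresh T, \<sigma>)) Ts) (tt_cond fresh c)"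
| "tt_query fresh (SelectStar d Ts c) =
     SelectStar d (map (\<lambda>(T, \<sigma>). (tt_table fresh T, \<sigma>)) Ts) (tt_cond fresh c)"
| "tt_query fresh (SetOp op al Q1 Q2) = SetOp op al (tt_query fresh Q1) (tt_query fresh Q2)"
| "tt_table fresh (BaseTable x) = BaseTable x"
| "tt_table fresh (QueryTable Q) = QueryTable (tt_query fresh Q)"
| "tt_cond fresh CTrue = CTrue"
| "tt_cond fresh CFalse = CFalse"
| "tt_cond fresh (IsNull b t) = IsNull b t"
| "tt_cond fresh (Pred n P ts) = Pred n P ts"
| "tt_cond fresh (Memb b ts Q) =
     (if b then Memb True ts (tt_query fresh Q) else tr_not_in fresh ts (tt_query fresh Q))"
| "tt_cond fresh (CExists Q) = CExists (tt_query fresh Q)"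
| "tt_cond fresh (CAnd c1 c2) = CAnd (tt_cond fresh c1) (tt_cond fresh c2)"
| "tt_cond fresh (COr c1 c2) = COr (tt_cond fresh c1) (tt_cond fresh c2)"
| "tt_cond fresh (CNot c) = ff_cond fresh c"
| "ff_cond fresh CTrue = CFalse"
| "ff_cond fresh CFalse = CTrue"
| "ff_cond fresh (IsNull b t) = IsNull (\<not> b) t"
| "ff_cond fresh (Pred n P ts) = CAnd (CNot (Pred n P ts)) (conj_list (map (IsNull False) ts))"
| "ff_cond fresh (Memb b ts Q) =
     (if b then tr_not_in fresh ts (tt_query fresh Q) else Memb True ts (tt_query fresh Q))"
| "ff_cond fresh (CExists Q) = CNot (CExists (tt_query fresh Q))"
| "ff_cond fresh (CAnd c1 c2) = COr (ff_cond fresh c1) (ff_cond fresh c2)"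
| "ff_cond fresh (COr c1 c2) = CAnd (ff_cond fresh c1) (ff_cond fresh c2)"
| "ff_cond fresh (CNot c) = tt_cond fresh c"

section \<open>Relations, databases and environments\<close>

type_synonym 'k relation = "'k val list multiset"
type_synonym ('x, 'k) db = "'x \<rightharpoonup> 'x schema \<times> 'k relation"
type_synonym 'k env = "'k val list list"

definition wf_db :: "('x, 'k) db \<Rightarrow> bool" where
  "wf_db D \<longleftrightarrow> (\<forall>x \<sigma> r. D x = Some (\<sigma>, r) \<longrightarrow> (\<forall>v \<in># r. length v = length \<sigma>))"

definition rel_times :: "'k relation \<Rightarrow> 'k relation \<Rightarrow> 'k relation" where
  "rel_times r s = (\<Sum>v \<in># r. image_mset (\<lambda>w. v @ w) s)"

definition dedup :: "'k relation \<Rightarrow> 'k relation" where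
  "dedup r = mset_set (set_mset r)"

definition dedup_if :: "bool \<Rightarrow> 'k relation \<Rightarrow> 'k relation" where
  "dedup_if d r = (if d then dedup r else r)"

text \<open>The flag is ALL. Without ALL, EXCEPT deduplicates its left operand, not the result.\<close>

fun setop_sem :: "setop \<Rightarrow> bool \<Rightarrow> 'k relation \<Rightarrow> 'k relation \<Rightarrow> 'k relation" where
  "setop_sem OpUnion al r s = dedup_if (\<not> al) (r + s)"
| "setop_sem OpIntersect al r s = dedup_if (\<not> al) (r \<inter># s)"
| "setop_sem OpExcept al r s = dedup_if (\<not> al) r - s"

definition is_env :: "'x ctx \<Rightarrow> 'k env \<Rightarrow> bool" where
  "is_env \<Gamma> \<eta> \<longleftrightarrow> list_all2 (\<lambda>\<sigma> vs. length vs = length \<sigma>) \<Gamma> \<eta>"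

fun env_of_tuple :: "'x ctx \<Rightarrow> 'k val list \<Rightarrow> 'k env" where
  "env_of_tuple [] v = []"
| "env_of_tuple (\<sigma> # \<Gamma>) v = take (length \<sigma>) v # env_of_tuple \<Gamma> (drop (length \<sigma>) v)"

section \<open>Truth values\<close>

record 'b truth =
  btrue :: 'b
  bfalse :: 'b
  bmaybe :: 'b
  band :: "'b \<Rightarrow> 'b \<Rightarrow> 'b"
  bor :: "'b \<Rightarrow> 'b \<Rightarrow> 'b"
  bneg :: "'b \<Rightarrow> 'b"

definition bool_to :: "'b truth \<Rightarrow> bool \<Rightarrow> 'b" where
  "bool_to B b = (if b then btrue B else bfalse B)"

definition is_btrue :: "'b truth \<Rightarrow> 'b \<Rightarrow> bool" where
  "is_btrue B b \<longleftrightarrow> b = btrue B"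

definition is_bfalse :: "'b truth \<Rightarrow> 'b \<Rightarrow> bool" where
  "is_bfalse B b \<longleftrightarrow> b = bfalse B"

definition veq :: "'b truth \<Rightarrow> 'k val \<Rightarrow> 'k val \<Rightarrow> 'b" where
  "veq B v w = (if v = None \<or> w = None then bmaybe B else bool_to B (v = w))"

datatype tv3 = TTrue | TFalse | Unknown

fun and3 :: "tv3 \<Rightarrow> tv3 \<Rightarrow> tv3" where
  "and3 TTrue b = b"
| "and3 TFalse b = TFalse"
| "and3 Unknown b = (if b = TFalse then TFalse else Unknown)"

fun or3 :: "tv3 \<Rightarrow> tv3 \<Rightarrow> tv3" where
  "or3 TTrue b = TTrue"
| "or3 TFalse b = b"
| "or3 Unknown b = (if b = TTrue then TTrue else Unknown)"

fun neg3 :: "tv3 \<Rightarrow> tv3" where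
  "neg3 TTrue = TFalse"
| "neg3 TFalse = TTrue"
| "neg3 Unknown = Unknown"

definition VL3 :: "tv3 truth" where
  "VL3 = \<lparr> btrue = TTrue, bfalse = TFalse, bmaybe = Unknown,
           band = and3, bor = or3, bneg = neg3 \<rparr>"

definition VL2 :: "bool truth" where
  "VL2 = \<lparr> btrue = True, bfalse = False, bmaybe = False,
           band = (\<and>), bor = (\<or>), bneg = HOL.Not \<rparr>"

section \<open>Semantics\<close>

text \<open>An evaluation in context \<open>\<Gamma>\<close> is a function on all environments, but only its values on
  those satisfying \<open>is_env \<Gamma>\<close> are meaningful.\<close>

inductive tm_sem :: "'x ctx \<Rightarrow> ('x, 'k) tm \<Rightarrow> ('k env \<Rightarrow> 'k val) \<Rightarrow> bool" where
  tm_attr: "\<lbrakk> n < length \<Gamma>; count_list (\<Gamma> ! n) x = 1; i < length (\<Gamma> ! n); \<Gamma> ! n ! i = x \<rbrakk>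
    \<Longrightarrow> tm_sem \<Gamma> (Attr n x) (\<lambda>\<eta>. \<eta> ! n ! i)"
| tm_const: "tm_sem \<Gamma> (Const k) (\<lambda>\<eta>. Some k)"
| tm_null: "tm_sem \<Gamma> NullTm (\<lambda>\<eta>. None)"

inductive tms_sem :: "'x ctx \<Rightarrow> ('x, 'k) tm list \<Rightarrow> ('k env \<Rightarrow> 'k val list) \<Rightarrow> bool" where
  tms_nil: "tms_sem \<Gamma> [] (\<lambda>\<eta>. [])"
| tms_cons: "\<lbrakk> tm_sem \<Gamma> t S; tms_sem \<Gamma> ts Ss \<rbrakk> \<Longrightarrow> tms_sem \<Gamma> (t # ts) (\<lambda>\<eta>. S \<eta> # Ss \<eta>)"

definition pred_sem :: "'b truth \<Rightarrow> ('k list \<Rightarrow> bool) \<Rightarrow> 'k val list \<Rightarrow> 'b" where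
  "pred_sem B P vs = (if None \<in> set vs then bmaybe B else bool_to B (P (map the vs)))"

text \<open>The flag is \<open>True\<close> for IN and \<open>False\<close> for NOT IN.\<close>

definition memb_sem :: "'b truth \<Rightarrow> bool \<Rightarrow> 'k val list \<Rightarrow> 'k relation \<Rightarrow> 'b" where
  "memb_sem B b vs r =
    (if \<exists>w \<in># r. list_all2 (\<lambda>x y. is_btrue B (veq B x y)) w vs then bool_to B b
     else if \<exists>w \<in># r. list_all2 (\<lambda>x y. \<not> is_bfalse B (veq B x y)) w vs then bmaybe B
     else bool_to B (\<not> b))"

definition where_sem :: "'b truth \<Rightarrow> 'x ctx \<Rightarrow> ('k env \<Rightarrow> 'b) \<Rightarrow> ('k env \<Rightarrow> 'k relation) \<Rightarrow> 'k env \<Rightarrow> 'k relation"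
  where "where_sem B \<Gamma>' Sc SF \<eta> = {# v \<in># SF \<eta>. is_btrue B (Sc (env_of_tuple \<Gamma>' v @ \<eta>)) #}"

definition select_sem :: "'b truth \<Rightarrow> bool \<Rightarrow> 'x ctx \<Rightarrow> ('k env \<Rightarrow> 'k val list) \<Rightarrow> ('k env \<Rightarrow> 'b) \<Rightarrow>
    ('k env \<Rightarrow> 'k relation) \<Rightarrow> 'k env \<Rightarrow> 'k relation" where
  "select_sem B d \<Gamma>' St Sc SF \<eta> =
    dedup_if d (image_mset (\<lambda>v. St (env_of_tuple \<Gamma>' v @ \<eta>)) (where_sem B \<Gamma>' Sc SF \<eta>))"

definition star_tms :: "'x ctx \<Rightarrow> ('x, 'k) tm list" where
  "star_tms \<Gamma>' = concat (map (\<lambda>i. map (Attr i) (\<Gamma>' ! i)) [0..<length \<Gamma>'])"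

inductive query_sem :: "'b truth \<Rightarrow> ('x, 'k) db \<Rightarrow> 'x ctx \<Rightarrow> ('x, 'k) query \<Rightarrow> 'x schema \<Rightarrow>
      ('k env \<Rightarrow> 'k relation) \<Rightarrow> bool"
  and nested_sem :: "'b truth \<Rightarrow> ('x, 'k) db \<Rightarrow> 'x ctx \<Rightarrow> ('x, 'k) query \<Rightarrow>
      ('k env \<Rightarrow> bool) \<Rightarrow> bool"
  and table_sem :: "'b truth \<Rightarrow> ('x, 'k) db \<Rightarrow> 'x ctx \<Rightarrow> ('x, 'k) table \<Rightarrow> 'x schema \<Rightarrow>
      ('k env \<Rightarrow> 'k relation) \<Rightarrow> bool"
  and from_sem :: "'b truth \<Rightarrow> ('x, 'k) db \<Rightarrow> 'x ctx \<Rightarrow> (('x, 'k) table \<times> 'x schema) list \<Rightarrow>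
      'x ctx \<Rightarrow> ('k env \<Rightarrow> 'k relation) \<Rightarrow> bool"
  and cond_sem :: "'b truth \<Rightarrow> ('x, 'k) db \<Rightarrow> 'x ctx \<Rightarrow> ('x, 'k) cond \<Rightarrow>
      ('k env \<Rightarrow> 'b) \<Rightarrow> bool"
  for B :: "'b truth" and D :: "('x, 'k) db"
where
  query_select:
    "\<lbrakk> from_sem B D \<Gamma> Ts \<Gamma>' SF; cond_sem B D (\<Gamma>' @ \<Gamma>) c Sc;
       tms_sem (\<Gamma>' @ \<Gamma>) (map fst txs) St \<rbrakk>
     \<Longrightarrow> query_sem B D \<Gamma> (Select d txs Ts c) (map snd txs) (select_sem B d \<Gamma>' St Sc SF)"
| query_star:
    "\<lbrakk> from_sem B D \<Gamma> Ts \<Gamma>' SF; cond_sem B D (\<Gamma>' @ \<Gamma>) c Sc;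
       tms_sem (\<Gamma>' @ \<Gamma>) (star_tms \<Gamma>') St \<rbrakk>
     \<Longrightarrow> query_sem B D \<Gamma> (SelectStar d Ts c) (concat \<Gamma>') (select_sem B d \<Gamma>' St Sc SF)"
| query_setop:
    "\<lbrakk> query_sem B D \<Gamma> Q1 \<tau> S1; query_sem B D \<Gamma> Q2 \<tau> S2 \<rbrakk>
     \<Longrightarrow> query_sem B D \<Gamma> (SetOp op al Q1 Q2) \<tau> (\<lambda>\<eta>. setop_sem op al (S1 \<eta>) (S2 \<eta>))"

| nested_select:
    "\<lbrakk> from_sem B D \<Gamma> Ts \<Gamma>' SF; cond_sem B D (\<Gamma>' @ \<Gamma>) c Sc;
       tms_sem (\<Gamma>' @ \<Gamma>) (map fst txs) St \<rbrakk>
     \<Longrightarrow> nested_sem B D \<Gamma> (Select d txs Ts c) (\<lambda>\<eta>. size (select_sem B d \<Gamma>' St Sc SF \<eta>) > 0)"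
| nested_star:
    "\<lbrakk> from_sem B D \<Gamma> Ts \<Gamma>' SF; cond_sem B D (\<Gamma>' @ \<Gamma>) c Sc \<rbrakk>
     \<Longrightarrow> nested_sem B D \<Gamma> (SelectStar d Ts c)
           (\<lambda>\<eta>. size (dedup_if d (where_sem B \<Gamma>' Sc SF \<eta>)) > 0)"
| nested_setop:
    "\<lbrakk> query_sem B D \<Gamma> Q1 \<tau> S1; query_sem B D \<Gamma> Q2 \<tau> S2 \<rbrakk>
     \<Longrightarrow> nested_sem B D \<Gamma> (SetOp op al Q1 Q2) (\<lambda>\<eta>. size (setop_sem op al (S1 \<eta>) (S2 \<eta>)) > 0)"

| table_base:
    "D x = Some (\<sigma>, r) \<Longrightarrow> table_sem B D \<Gamma> (BaseTable x) \<sigma> (\<lambda>\<eta>. r)"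
| table_query:
    "query_sem B D \<Gamma> Q \<sigma> S \<Longrightarrow> table_sem B D \<Gamma> (QueryTable Q) \<sigma> S"

| from_nil:
    "from_sem B D \<Gamma> [] [] (\<lambda>\<eta>. {# [] #})"
| from_cons:
    "\<lbrakk> table_sem B D \<Gamma> T \<sigma> S; length \<sigma> = length \<rho>; from_sem B D \<Gamma> Ts \<Gamma>' SF \<rbrakk>
     \<Longrightarrow> from_sem B D \<Gamma> ((T, \<rho>) # Ts) (\<rho> # \<Gamma>') (\<lambda>\<eta>. rel_times (S \<eta>) (SF \<eta>))"

| cond_true:
    "cond_sem B D \<Gamma> CTrue (\<lambda>\<eta>. btrue B)"
| cond_false:
    "cond_sem B D \<Gamma> CFalse (\<lambda>\<eta>. bfalse B)"
| cond_null:
    "tm_sem \<Gamma> t S \<Longrightarrow> cond_sem B D \<Gamma> (IsNull b t) (\<lambda>\<eta>. bool_to B ((S \<eta> = None) = b))"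
| cond_pred:
    "\<lbrakk> length ts = n; tms_sem \<Gamma> ts St \<rbrakk>
     \<Longrightarrow> cond_sem B D \<Gamma> (Pred n P ts) (\<lambda>\<eta>. pred_sem B P (St \<eta>))"
| cond_memb:
    "\<lbrakk> tms_sem \<Gamma> ts St; query_sem B D \<Gamma> Q \<sigma> SQ; length \<sigma> = length ts \<rbrakk>
     \<Longrightarrow> cond_sem B D \<Gamma> (Memb b ts Q) (\<lambda>\<eta>. memb_sem B b (St \<eta>) (SQ \<eta>))"
| cond_exists:
    "nested_sem B D \<Gamma> Q S \<Longrightarrow> cond_sem B D \<Gamma> (CExists Q) (\<lambda>\<eta>. bool_to B (S \<eta>))"
| cond_and:
    "\<lbrakk> cond_sem B D \<Gamma> c1 S1; cond_sem B D \<Gamma> c2 S2 \<rbrakk>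
     \<Longrightarrow> cond_sem B D \<Gamma> (CAnd c1 c2) (\<lambda>\<eta>. band B (S1 \<eta>) (S2 \<eta>))"
| cond_or:
    "\<lbrakk> cond_sem B D \<Gamma> c1 S1; cond_sem B D \<Gamma> c2 S2 \<rbrakk>
     \<Longrightarrow> cond_sem B D \<Gamma> (COr c1 c2) (\<lambda>\<eta>. bor B (S1 \<eta>) (S2 \<eta>))"
| cond_not:
    "cond_sem B D \<Gamma> c S \<Longrightarrow> cond_sem B D \<Gamma> (CNot c) (\<lambda>\<eta>. bneg B (S \<eta>))"

end

theory Submission
  imports Defs
begin

text \<open>The translation preserves the evaluation as a function on all value lists, not only on
  environments. Conditions carry the invariant: if \<open>c\<close> evaluates to \<open>S\<close> in 3VL, then in 2VL its
  \<open>tt\<close>-translation evaluates to ``\<open>S\<close> is true'' and its \<open>ff\<close>-translation to ``\<open>S\<close> is false''.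
  This is preserved by every rule of the semantics; the only rule that needs more is NOT IN, where
  the emptiness of the translated subquery expresses that no tuple of \<open>Q\<close> is possibly
  equal to the tuple sought.\<close>

section \<open>Finiteness of the sets of names\<close>

lemma finite_tm_names [simp]: "finite (tm_names t)"
  by (cases t) auto

text \<open>\<open>name_supply\<close> promises distinct names only when the set to avoid is finite,
  so this is what yields usable names for the NOT IN subquery.\<close>

lemma
  fixes Q :: "('x, 'k) query" and T :: "('x, 'k) table" and c :: "('x, 'k) cond"
  shows finite_query_names: "finite (query_names Q)" and
  finite_table_names: "finite (table_names T)" and
  finite_cond_names: "finite (cond_names c)"
  by (induction Q and T and c rule: query.induct table.induct cond.induct)
    (fastforce elim: fsts.cases snds.cases)+

section \<open>Elements and tuple lengths of evaluated relations\<close>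

lemma set_mset_dedup [simp]: "set_mset (dedup r) = set_mset r"
  by (simp add: dedup_def)

lemma set_mset_dedup_if [simp]: "set_mset (dedup_if d r) = set_mset r"
  by (simp add: dedup_if_def)

lemma set_mset_rel_times: "set_mset (rel_times r s) = (\<lambda>(v, w). v @ w) ` (set_mset r \<times> set_mset s)"
  by (auto simp: rel_times_def)

lemma rel_times_unit [simp]: "rel_times r {#[]#} = r"
  by (simp add: rel_times_def)

lemma set_mset_setop_sem: "set_mset (setop_sem op al r s) \<subseteq> set_mset r \<union> set_mset s"
  by (cases op) (auto simp flip: count_greater_zero_iff simp: dedup_if_def dest: in_diffD)

lemma tms_sem_length: "tms_sem \<Gamma> ts St \<Longrightarrow> length (St \<eta>) = length ts"
  by (induction rule: tms_sem.induct) auto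

lemma length_star_tms: "length (star_tms \<Gamma>') = length (concat \<Gamma>')"
proof -
  have "map (\<lambda>i. length (\<Gamma>' ! i)) [0..<length \<Gamma>'] = map length \<Gamma>'"
    by (auto intro: nth_equalityI)
  then show ?thesis
    by (simp add: star_tms_def length_concat comp_def)
qed

lemma select_sem_elem:
  "v \<in># select_sem B d \<Gamma>' St Sc SF \<eta> \<Longrightarrow> \<exists>\<eta>'. v = St \<eta>'"
  by (auto simp: select_sem_def)

text \<open>This serves the NOT IN case: \<open>list_all2\<close> rejects a tuple of the wrong
  length, whereas \<open>env_of_tuple\<close> would cut a longer one to size.\<close>

lemma
  assumes "wf_db D"
  shows query_sem_length: "query_sem B D \<Gamma> Q \<tau> S \<Longrightarrow> v \<in># S \<eta> \<Longrightarrow> length v = length \<tau>"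
    and "nested_sem B D \<Gamma> Q N \<Longrightarrow> True"
    and table_sem_length: "table_sem B D \<Gamma> T \<tau> S \<Longrightarrow> v \<in># S \<eta> \<Longrightarrow> length v = length \<tau>"
    and from_sem_length: "from_sem B D \<Gamma> Ts \<Gamma>' S \<Longrightarrow> v \<in># S \<eta> \<Longrightarrow> length v = length (concat \<Gamma>')"
    and "cond_sem B D \<Gamma> c Sc \<Longrightarrow> True"
proof (induction arbitrary: v and v and v and v and v
    rule: query_sem_nested_sem_table_sem_from_sem_cond_sem.inducts)
  case query_select
  then show ?case
    by (auto dest!: select_sem_elem simp: tms_sem_length)
next
  case query_star
  then show ?case
    by (auto dest!: select_sem_elem simp: tms_sem_length length_star_tms)
next
  case query_setop
  then show ?case
    using set_mset_setop_sem by fastforce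
next
  case table_base
  then show ?case
    using assms by (auto simp: wf_db_def)
next
  case from_cons
  then show ?case
    by (fastforce simp: set_mset_rel_times)
qed auto

text \<open>The introduction rules fix the syntactic form of the evaluation; pointwise equality lets
  a derivation be restated with the form wanted.\<close>

lemma cond_sem_cong:
  "cond_sem B D \<Gamma> c S \<Longrightarrow> (\<And>\<eta>. S \<eta> = S' \<eta>) \<Longrightarrow> cond_sem B D \<Gamma> c S'"
  by (simp add: ext[of S S'])

section \<open>Truth values, conjunctions and lifted terms\<close>

lemma VL2_simps [simp]:
  "btrue VL2 = True" "bfalse VL2 = False" "bmaybe VL2 = False"
  "band VL2 = (\<and>)" "bor VL2 = (\<or>)" "bneg VL2 = HOL.Not"
  "is_btrue VL2 b = b" "is_bfalse VL2 b = (\<not> b)" "bool_to VL2 b = b"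
  by (simp_all add: VL2_def is_btrue_def is_bfalse_def bool_to_def)

lemma VL3_simps [simp]:
  "btrue VL3 = TTrue" "bfalse VL3 = TFalse" "bmaybe VL3 = Unknown"
  "band VL3 = and3" "bor VL3 = or3" "bneg VL3 = neg3"
  "is_btrue VL3 (bool_to VL3 b) = b" "is_bfalse VL3 (bool_to VL3 b) = (\<not> b)"
  "is_btrue VL3 TTrue" "\<not> is_btrue VL3 TFalse" "\<not> is_btrue VL3 Unknown"
  "\<not> is_bfalse VL3 TTrue" "is_bfalse VL3 TFalse" "\<not> is_bfalse VL3 Unknown"
  by (simp_all add: VL3_def is_btrue_def is_bfalse_def bool_to_def)

lemma conj_list_simps [simp]:
  "conj_list [] = CTrue" "conj_list (c # cs) = CAnd c (conj_list cs)"
  by (simp_all add: conj_list_def)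

text \<open>In 2VL a predicate with a NULL argument is false, so its negation alone would be true;
  this conjunction in the \<open>ff\<close> translation excludes that case.\<close>

lemma cond_sem_all_not_null:
  assumes "tms_sem \<Gamma> ts St"
  shows "cond_sem VL2 D \<Gamma> (conj_list (map (IsNull False) ts)) (\<lambda>\<eta>. None \<notin> set (St \<eta>))"
  using assms
proof (induction rule: tms_sem.induct)
  case (tms_nil \<Gamma>)
  have "cond_sem VL2 D \<Gamma> CTrue (\<lambda>\<eta>. btrue VL2)"
    by (rule cond_true)
  then show ?case
    by simp
next
  case (tms_cons \<Gamma> t S ts Ss)
  show ?case
    unfolding list.map conj_list_simps
    by (rule cond_sem_cong[OF cond_and[OF cond_null[OF tms_cons.hyps(1)] tms_cons.IH]])
      (auto simp: neq_commute[of None])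
qed

text \<open>The equation is restricted to nonempty environments because \<open>[] ! n\<close> is unspecified.\<close>

lemma tm_sem_lift:
  assumes "tm_sem \<Gamma> t S"
  obtains S' where "tm_sem (\<sigma> # \<Gamma>) (lift_tm t) S'" "\<And>u \<eta>. S' (u # \<eta>) = S \<eta>"
  using assms
proof cases
  case (tm_attr n x i)
  have "tm_sem (\<sigma> # \<Gamma>) (Attr (Suc n) x) (\<lambda>\<eta>. \<eta> ! Suc n ! i)"
    using tm_attr by (intro tm_sem.tm_attr) auto
  then show ?thesis
    using that tm_attr by (metis lift_tm.simps(1) nth_Cons_Suc)
next
  case (tm_const k)
  show ?thesis
    using that[of "\<lambda>_. Some k"] tm_const by (simp add: tm_sem.tm_const)
next
  case tm_null
  show ?thesis
    using that[of "\<lambda>_. None"] tm_null by (simp add: tm_sem.tm_null)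
qed

section \<open>The condition of the NOT IN subquery\<close>

abbreviation possibly_eq :: "'k val \<Rightarrow> 'k val \<Rightarrow> bool" where
  "possibly_eq v w \<equiv> \<not> is_bfalse VL3 (veq VL3 v w)"

abbreviation possibly_eq_cond :: "'x \<Rightarrow> ('x, 'k) tm \<Rightarrow> ('x, 'k) cond" where
  "possibly_eq_cond a t \<equiv>
    COr (IsNull True (Attr 0 a)) (COr (IsNull True (lift_tm t)) (eq_cond (lift_tm t) (Attr 0 a)))"

text \<open>In Kleene logic, \<open>possibly_eq v w\<close> means that \<open>v\<close> is NULL, or
  \<open>w\<close> is NULL, or both are the same constant: one case for each disjunct of the
  condition.\<close>

lemma cond_sem_possibly_eq:
  assumes t: "tm_sem \<Gamma> t S" and a: "distinct \<sigma>" "i < length \<sigma>" "\<sigma> ! i = a"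
  obtains S' where "cond_sem VL2 D (\<sigma> # \<Gamma>) (possibly_eq_cond a t) S'"
    "\<And>u \<eta>. S' (u # \<eta>) \<longleftrightarrow> possibly_eq (u ! i) (S \<eta>)"
proof -
  obtain S1 where S1: "tm_sem (\<sigma> # \<Gamma>) (lift_tm t) S1" and S1_eq: "\<And>u \<eta>. S1 (u # \<eta>) = S \<eta>"
    using tm_sem_lift[OF t] by blast
  \<comment> \<open>An attribute evaluates only if its name occurs exactly once in its
    schema.\<close>
  have "count_list \<sigma> a = 1"
    using a by (auto simp: count_list_eq_length_filter distinct_length_filter Int_absorb2)
  then have A: "tm_sem (\<sigma> # \<Gamma>) (Attr 0 a) (\<lambda>\<eta>. \<eta> ! 0 ! i)"
    using a by (intro tm_attr) auto
  have E: "cond_sem VL2 D (\<sigma> # \<Gamma>) (eq_cond (lift_tm t) (Attr 0 a))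
      (\<lambda>\<eta>. pred_sem VL2 (\<lambda>ks. ks ! 0 = ks ! 1) [S1 \<eta>, \<eta> ! 0 ! i])"
    unfolding eq_cond_def by (intro cond_pred tms_cons tms_nil S1 A) simp
  show thesis
    by (rule that[OF cond_or[OF cond_null[OF A] cond_or[OF cond_null[OF S1] E]]])
      (auto simp: S1_eq veq_def pred_sem_def)
qed

text \<open>All conjuncts live in one schema, while the induction consumes \<open>as\<close> from
  the left. Moving each consumed name to the end of \<open>pre\<close> keeps
  \<open>pre @ as\<close>, and hence the context, fixed; \<open>v\<close> holds the values of
  \<open>pre\<close>.\<close>

lemma cond_sem_all_possibly_eq:
  assumes "tms_sem \<Gamma> ts St" "length as = length ts" "distinct (pre @ as)"
  shows "\<exists>S'. cond_sem VL2 D ((pre @ as) # \<Gamma>) (conj_list (map2 possibly_eq_cond as ts)) S' \<and>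
    (\<forall>v w \<eta>. length v = length pre \<longrightarrow> length w = length as \<longrightarrow>
      S' ((v @ w) # \<eta>) = list_all2 possibly_eq w (St \<eta>))"
  using assms
proof (induction arbitrary: pre as rule: tms_sem.induct)
  case (tms_nil \<Gamma>)
  have "cond_sem VL2 D ((pre @ as) # \<Gamma>) CTrue (\<lambda>\<eta>. btrue VL2)"
    by (rule cond_true)
  with tms_nil show ?case
    by (intro exI[of _ "\<lambda>_. True"]) simp
next
  case (tms_cons \<Gamma> t S ts Ss)
  then obtain a as' where as: "as = a # as'"
    by (cases as) auto
  \<comment> \<open>The name \<open>a\<close> sits at position \<open>length pre\<close>, so it
    reads the first entry of \<open>w\<close>.\<close>
  obtain S1 where S1: "cond_sem VL2 D ((pre @ as) # \<Gamma>) (possibly_eq_cond a t) S1"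
    and S1_eq: "\<And>u \<eta>. S1 (u # \<eta>) \<longleftrightarrow> possibly_eq (u ! length pre) (S \<eta>)"
    by (rule cond_sem_possibly_eq[OF tms_cons.hyps(1), where \<sigma> = "pre @ as" and i = "length pre"])
      (use tms_cons.prems as in auto)
  obtain S2 where S2: "cond_sem VL2 D ((pre @ as) # \<Gamma>) (conj_list (map2 possibly_eq_cond as' ts)) S2"
    and S2_eq: "\<And>v w \<eta>. length v = Suc (length pre) \<Longrightarrow> length w = length as' \<Longrightarrow>
      S2 ((v @ w) # \<eta>) = list_all2 possibly_eq w (Ss \<eta>)"
    using tms_cons.IH[of as' "pre @ [a]"] tms_cons.prems as by auto
  have "cond_sem VL2 D ((pre @ as) # \<Gamma>) (conj_list (map2 possibly_eq_cond as (t # ts)))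
      (\<lambda>\<eta>. band VL2 (S1 \<eta>) (S2 \<eta>))"
    using cond_and[OF S1 S2] as by simp
  moreover have "band VL2 (S1 ((v @ w) # \<eta>)) (S2 ((v @ w) # \<eta>)) =
      list_all2 possibly_eq w (S \<eta> # Ss \<eta>)"
    if lengths: "length v = length pre" "length w = length as" for v w \<eta>
  proof -
    obtain x w' where w: "w = x # w'" and len: "length w' = length as'"
      using lengths(2) as by (auto simp: length_Suc_conv)
    have "S2 ((v @ w) # \<eta>) = list_all2 possibly_eq w' (Ss \<eta>)"
      using S2_eq[of "v @ [x]" w' \<eta>] lengths len w by simp
    then show ?thesis
      using lengths w by (simp add: S1_eq nth_append)
  qed
  ultimately show ?case
    by blast
qed

lemma cond_sem_tr_not_in:
  assumes "name_supply fresh" "tms_sem \<Gamma> ts St" "query_sem VL2 D \<Gamma> Q \<sigma> SQ"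
    and "length \<sigma> = length ts"
    and len: "\<And>\<eta> w. w \<in># SQ \<eta> \<Longrightarrow> length w = length ts"
  shows "cond_sem VL2 D \<Gamma> (tr_not_in fresh ts Q)
    (\<lambda>\<eta>. \<not> (\<exists>w \<in># SQ \<eta>. list_all2 possibly_eq w (St \<eta>)))"
proof -
  define as where "as = fresh (length ts) (cond_names (Memb True ts Q))"
  have as: "length as = length ts" "distinct as"
    using assms(1) finite_cond_names[of "Memb True ts Q"] unfolding name_supply_def as_def by blast+
  obtain Sc where Sc: "cond_sem VL2 D (as # \<Gamma>) (conj_list (map2 possibly_eq_cond as ts)) Sc"
    and Sc_eq: "\<And>w \<eta>. length w = length ts \<Longrightarrow> Sc (w # \<eta>) = list_all2 possibly_eq w (St \<eta>)"
    using cond_sem_all_possibly_eq[OF assms(2) as(1), of "[]" D] as by auto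
  \<comment> \<open>For a single table, \<open>from_cons\<close> still forms a product, with the
    unit relation that holds only the empty tuple.\<close>
  have "from_sem VL2 D \<Gamma> [(QueryTable Q, as)] [as] (\<lambda>\<eta>. rel_times (SQ \<eta>) {#[]#})"
    using assms as by (intro from_cons from_nil table_query) auto
  then have F: "from_sem VL2 D \<Gamma> [(QueryTable Q, as)] [as] SQ"
    by simp
  have "cond_sem VL2 D ([as] @ \<Gamma>) (conj_list (map2 possibly_eq_cond as ts)) Sc"
    using Sc by simp
  note N = cond_not[OF cond_exists[OF nested_star[OF F this, of False]]]
  show ?thesis
    unfolding tr_not_in_def Let_def as_def[symmetric]
    \<comment> \<open>The environment of the subquery starts with \<open>take (length as) w\<close>;
      \<open>len\<close> makes this all of \<open>w\<close>, so that \<open>Sc_eq\<close>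
      applies.\<close>
    by (rule cond_sem_cong[OF N])
      (auto simp: where_sem_def dedup_if_def nonempty_has_size[symmetric] as(1) len Sc_eq)
qed

section \<open>Comparison of three-valued and two-valued truth\<close>

lemma memb_sem_VL3:
  "is_btrue VL3 (memb_sem VL3 True vs r) = memb_sem VL2 True vs r"
  "is_bfalse VL3 (memb_sem VL3 False vs r) = memb_sem VL2 True vs r"
  "is_bfalse VL3 (memb_sem VL3 True vs r) \<longleftrightarrow> \<not> (\<exists>w \<in># r. list_all2 possibly_eq w vs)"
  "is_btrue VL3 (memb_sem VL3 False vs r) \<longleftrightarrow> \<not> (\<exists>w \<in># r. list_all2 possibly_eq w vs)"
proof -
  \<comment> \<open>Both sides are false on NULL, so the certain matches are the same in both
    logics.\<close>
  have eq2: "veq VL2 x y = is_btrue VL3 (veq VL3 x y)" for x y :: "'a val"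
    by (auto simp: veq_def)
  \<comment> \<open>A certain match is also a possible one, so in 3VL the last branch of
    \<open>memb_sem\<close> is reached exactly when there is no possible match.\<close>
  have mono: "list_all2 possibly_eq w vs"
    if "list_all2 (\<lambda>x y. is_btrue VL3 (veq VL3 x y)) w vs" for w :: "'a val list"
    using that by (rule list_all2_mono) (auto simp: veq_def split: if_splits)
  show "is_btrue VL3 (memb_sem VL3 True vs r) = memb_sem VL2 True vs r"
    "is_bfalse VL3 (memb_sem VL3 False vs r) = memb_sem VL2 True vs r"
    by (simp_all add: memb_sem_def eq2)
  show "is_bfalse VL3 (memb_sem VL3 True vs r) \<longleftrightarrow> \<not> (\<exists>w \<in># r. list_all2 possibly_eq w vs)"
    "is_btrue VL3 (memb_sem VL3 False vs r) \<longleftrightarrow> \<not> (\<exists>w \<in># r. list_all2 possibly_eq w vs)"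
    using mono by (auto simp: memb_sem_def)
qed

text \<open>Truth and falsity of Kleene connectives each obey Boolean laws, dual to each other by De
  Morgan, just as \<open>tt_cond\<close> and \<open>ff_cond\<close> treat the connectives.\<close>

lemma connectives_VL3:
  "is_btrue VL3 (and3 x y) \<longleftrightarrow> is_btrue VL3 x \<and> is_btrue VL3 y"
  "is_bfalse VL3 (and3 x y) \<longleftrightarrow> is_bfalse VL3 x \<or> is_bfalse VL3 y"
  "is_btrue VL3 (or3 x y) \<longleftrightarrow> is_btrue VL3 x \<or> is_btrue VL3 y"
  "is_bfalse VL3 (or3 x y) \<longleftrightarrow> is_bfalse VL3 x \<and> is_bfalse VL3 y"
  "is_btrue VL3 (neg3 x) = is_bfalse VL3 x"
  "is_bfalse VL3 (neg3 x) = is_btrue VL3 x"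
  by (cases x; cases y; simp)+

text \<open>Simplified goals contain the logical connectives instead of \<open>band VL2\<close> and
  \<open>bor VL2\<close>, so the rules are restated to unify with them.\<close>

lemmas cond_sem_VL2_connectives =
  cond_and[where B = VL2, unfolded VL2_simps] cond_or[where B = VL2, unfolded VL2_simps]

text \<open>WHERE keeps a row only if the condition is true, so merging false and unknown does not
  change the relation.\<close>

lemma where_sem_VL2:
  "where_sem VL2 \<Gamma>' (\<lambda>\<eta>. is_btrue VL3 (Sc \<eta>)) SF = where_sem VL3 \<Gamma>' Sc SF"
  by (simp add: fun_eq_iff where_sem_def)

lemma select_sem_VL2:
  "select_sem VL2 d \<Gamma>' St (\<lambda>\<eta>. is_btrue VL3 (Sc \<eta>)) SF = select_sem VL3 d \<Gamma>' St Sc SF"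
  by (simp add: fun_eq_iff select_sem_def where_sem_VL2)

section \<open>Preservation of evaluations under the translation\<close>

abbreviation tt_from where
  "tt_from fresh \<equiv> map (\<lambda>(T, \<sigma>). (tt_table fresh T, \<sigma>))"

lemma
  assumes fresh: "name_supply fresh" and D: "wf_db D"
  shows tt_query_sem:
      "query_sem VL3 D \<Gamma> Q \<tau> S \<Longrightarrow> query_sem VL2 D \<Gamma> (tt_query fresh Q) \<tau> S"
    and tt_nested_sem:
      "nested_sem VL3 D \<Gamma> Q N \<Longrightarrow> nested_sem VL2 D \<Gamma> (tt_query fresh Q) N"
    and tt_table_sem:
      "table_sem VL3 D \<Gamma> T \<tau> S \<Longrightarrow> table_sem VL2 D \<Gamma> (tt_table fresh T) \<tau> S"
    and tt_from_sem:
      "from_sem VL3 D \<Gamma> Ts \<Gamma>' S \<Longrightarrow> from_sem VL2 D \<Gamma> (tt_from fresh Ts) \<Gamma>' S"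
    and tt_ff_cond_sem:
      "cond_sem VL3 D \<Gamma> c Sc \<Longrightarrow>
        cond_sem VL2 D \<Gamma> (tt_cond fresh c) (\<lambda>\<eta>. is_btrue VL3 (Sc \<eta>)) \<and>
        cond_sem VL2 D \<Gamma> (ff_cond fresh c) (\<lambda>\<eta>. is_bfalse VL3 (Sc \<eta>))"
proof (induction rule: query_sem_nested_sem_table_sem_from_sem_cond_sem.inducts)
  case (query_select \<Gamma> Ts \<Gamma>' SF c Sc txs St d)
  then show ?case
    using query_sem_nested_sem_table_sem_from_sem_cond_sem.query_select
      [of VL2 D \<Gamma> "tt_from fresh Ts" \<Gamma>' SF "tt_cond fresh c" "\<lambda>\<eta>. is_btrue VL3 (Sc \<eta>)"]
    by (simp add: select_sem_VL2)
next
  case (query_star \<Gamma> Ts \<Gamma>' SF c Sc St d)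
  then show ?case
    using query_sem_nested_sem_table_sem_from_sem_cond_sem.query_star
      [of VL2 D \<Gamma> "tt_from fresh Ts" \<Gamma>' SF "tt_cond fresh c" "\<lambda>\<eta>. is_btrue VL3 (Sc \<eta>)"]
    by (simp add: select_sem_VL2)
next
  case (nested_select \<Gamma> Ts \<Gamma>' SF c Sc txs St d)
  then show ?case
    using query_sem_nested_sem_table_sem_from_sem_cond_sem.nested_select
      [of VL2 D \<Gamma> "tt_from fresh Ts" \<Gamma>' SF "tt_cond fresh c" "\<lambda>\<eta>. is_btrue VL3 (Sc \<eta>)"]
    by (simp add: select_sem_VL2)
next
  case (nested_star \<Gamma> Ts \<Gamma>' SF c Sc d)
  then show ?case
    using query_sem_nested_sem_table_sem_from_sem_cond_sem.nested_star
      [of VL2 D \<Gamma> "tt_from fresh Ts" \<Gamma>' SF "tt_cond fresh c" "\<lambda>\<eta>. is_btrue VL3 (Sc \<eta>)"]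
    by (simp add: where_sem_VL2)
next
  case (cond_true \<Gamma>)
  show ?case
    by (auto intro: cond_sem_cong
        query_sem_nested_sem_table_sem_from_sem_cond_sem.cond_true
        query_sem_nested_sem_table_sem_from_sem_cond_sem.cond_false)
next
  case (cond_false \<Gamma>)
  show ?case
    by (auto intro: cond_sem_cong
        query_sem_nested_sem_table_sem_from_sem_cond_sem.cond_true
        query_sem_nested_sem_table_sem_from_sem_cond_sem.cond_false)
next
  case (cond_null \<Gamma> t S b)
  note N = query_sem_nested_sem_table_sem_from_sem_cond_sem.cond_null[OF cond_null, where B = VL2]
  show ?case
    using cond_sem_cong[OF N[of D b], of "\<lambda>\<eta>. is_btrue VL3 (bool_to VL3 ((S \<eta> = None) = b))"]
      cond_sem_cong[OF N[of D "\<not> b"], of "\<lambda>\<eta>. is_bfalse VL3 (bool_to VL3 ((S \<eta> = None) = b))"]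
    by auto
next
  case (cond_pred ts n \<Gamma> St P)
  note P = query_sem_nested_sem_table_sem_from_sem_cond_sem.cond_pred[OF cond_pred, of VL2 D P]
  have "cond_sem VL2 D \<Gamma> (Pred n P ts) (\<lambda>\<eta>. is_btrue VL3 (pred_sem VL3 P (St \<eta>)))"
    by (rule cond_sem_cong[OF P]) (auto simp: pred_sem_def)
  moreover have "cond_sem VL2 D \<Gamma> (CAnd (CNot (Pred n P ts)) (conj_list (map (IsNull False) ts)))
      (\<lambda>\<eta>. is_bfalse VL3 (pred_sem VL3 P (St \<eta>)))"
    by (rule cond_sem_cong[OF cond_and[OF cond_not[OF P] cond_sem_all_not_null[OF cond_pred(2)]]])
      (auto simp: pred_sem_def)
  ultimately show ?case
    by simp
next
  case (cond_memb \<Gamma> ts St Q \<sigma> SQ b)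
  \<comment> \<open>\<open>IH(1)\<close> is the 3VL derivation; the translated query evaluates to
    the same \<open>SQ\<close>, so the length bound carries over.\<close>
  note len = query_sem_length[OF D cond_memb.IH(1)]
  have "cond_sem VL2 D \<Gamma> (tr_not_in fresh ts (tt_query fresh Q))
      (\<lambda>\<eta>. \<not> (\<exists>w \<in># SQ \<eta>. list_all2 possibly_eq w (St \<eta>)))"
    using fresh cond_memb.hyps(1) cond_memb.IH(2) cond_memb.hyps(2)
    by (rule cond_sem_tr_not_in) (use len cond_memb.hyps(2) in auto)
  moreover have "cond_sem VL2 D \<Gamma> (Memb True ts (tt_query fresh Q))
      (\<lambda>\<eta>. memb_sem VL2 True (St \<eta>) (SQ \<eta>))"
    using cond_memb by (intro query_sem_nested_sem_table_sem_from_sem_cond_sem.cond_memb)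
  \<comment> \<open>For IN, the \<open>Memb\<close> fact settles \<open>tt\<close> and the other one
    \<open>ff\<close>; for NOT IN they change places.\<close>
  ultimately show ?case
    by (cases b) (simp_all add: memb_sem_VL3)
next
  case (cond_exists \<Gamma> Q S)
  note E = query_sem_nested_sem_table_sem_from_sem_cond_sem.cond_exists[OF cond_exists.IH(2)]
  have "cond_sem VL2 D \<Gamma> (CExists (tt_query fresh Q)) (\<lambda>\<eta>. is_btrue VL3 (bool_to VL3 (S \<eta>)))"
    by (rule cond_sem_cong[OF E]) simp
  moreover have "cond_sem VL2 D \<Gamma> (CNot (CExists (tt_query fresh Q)))
      (\<lambda>\<eta>. is_bfalse VL3 (bool_to VL3 (S \<eta>)))"
    by (rule cond_sem_cong[OF cond_not[OF E]]) simp
  ultimately show ?case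
    by simp
qed (auto simp: connectives_VL3
    intro: cond_sem_VL2_connectives query_sem_nested_sem_table_sem_from_sem_cond_sem.intros)

theorem theorem3:
  fixes fresh :: "nat \<Rightarrow> 'x set \<Rightarrow> 'x list"
    and D :: "('x, 'k) db"
    and \<Gamma> :: "'x ctx"
    and Q :: "('x, 'k) query"
    and \<tau> :: "'x schema"
    and S :: "'k env \<Rightarrow> 'k relation"
  assumes "name_supply fresh"
    and "wf_db D"
    and "query_sem VL3 D \<Gamma> Q \<tau> S"
  shows "\<exists>S'. query_sem VL2 D \<Gamma> (tt_query fresh Q) \<tau> S' \<and> (\<forall>\<eta>. is_env \<Gamma> \<eta> \<longrightarrow> S \<eta> = S' \<eta>)"
  using tt_query_sem[OF assms] by blast

end
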